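(* Let $X$ be a simplicial complex. Then for any integer $k\geq 0$, $$C(X)\leq \mathcal{M}_k(X),$$ where $C(X)$ is the collapsibility number of $X$ and $\mathcal{M}_k(X)$ is the invariant defined recursively in the context.
   Context: Simplicial complexes are finite. If $\gamma,\sigma\in X$ with $|\gamma|\le d$ and $\sigma$ is the only maximal simplex of $X$ containing $\gamma$, then removing from $X$ all simplices $\tau$ with $\gamma\subseteq\tau\subseteq\sigma$ is an elementary $d$-collapse. $X$ is $d$-collapsible if some finite sequence of elementary $d$-collapses reduces $X$ to the empty (void) complex $\emptyset$. The collapsibility number $C(X)$ is the minimal integer $d$ such that $X$ is $d$-collapsible. For $\sigma\in X$: $\mathrm{lk}(\sigma,X)=\{\tau\in X:\sigma\cap\tau=\emptyset,\ \sigma\cup\tau\in X\}$ and $\mathrm{del}(\sigma,X)=\{\tau\in X:\sigma\not\subseteq\tau\}$ (for a vertex $v$ write $v$ for $\{v\}$). $V(X)$ is the set of vertices of $X$, and for $A\subseteq V(X)$, $X[A]=\{\sigma\in X:\sigma\subseteq A\}$. For $k\ge0$, $X_{(k)}$ is the set of $k$-dimensional faces of $X$, and $X_{(k)}^o=\{\sigma\in X_{(k)}:\mathrm{lk}(\sigma,X)\neq X[V(X)\setminus\sigma]\}$. Let $X^o$ be the set of vertices $v$ of $X$ with $\mathrm{lk}(v,X)\neq\mathrm{del}(v,X)$. Define $\mathcal{M}(X)=0$ if $X^o=\emptyset$, and otherwise $\mathcal{M}(X)=\min_{v\in X^o}\max\{\mathcal{M}(\mathrm{lk}(v,X))+1,\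 \mathcal{M}(\mathrm{del}(v,X))\}$. Define $\mathcal{M}_0(X)=\mathcal{M}'_0(X)=\mathcal{M}(X)$. For $k\ge1$, define inductively $\mathcal{M}'_k(X)=\mathcal{M}_{k-1}(X)$ if $X_{(k)}^o=\emptyset$, and otherwise $$\mathcal{M}'_k(X)=\min_{\sigma\in X_{(k)}^o}\max\{\mathcal{M}'_k(\mathrm{del}(\sigma,X)),\ \mathcal{M}'_k(\mathrm{lk}(\sigma,X))+k+1\};$$ and $\mathcal{M}_k(X)=\min\{\mathcal{M}'_k(X),\mathcal{M}_{k-1}(X)\}$. *)

theory Defs
  imports Main
begin

text \<open>Finite abstract simplicial complexes are sets of faces. The void complex is \<open>{}\<close>; every other
  complex contains the empty face, so \<open>{}\<close> and \<open>{{}}\<close> are distinct complexes.\<close>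

definition simplicial_complex :: "'a set set \<Rightarrow> bool" where
  "simplicial_complex X \<longleftrightarrow>
     finite X \<and> (\<forall>\<sigma>\<in>X. finite \<sigma>) \<and> (\<forall>\<sigma>\<in>X. \<forall>\<tau>. \<tau> \<subseteq> \<sigma> \<longrightarrow> \<tau> \<in> X)"

definition vertices :: "'a set set \<Rightarrow> 'a set" where
  "vertices X = {v. {v} \<in> X}"

definition maximal_simplex :: "'a set set \<Rightarrow> 'a set \<Rightarrow> bool" where
  "maximal_simplex X \<sigma> \<longleftrightarrow> \<sigma> \<in> X \<and> (\<forall>\<tau>\<in>X. \<sigma> \<subseteq> \<tau> \<longrightarrow> \<tau> = \<sigma>)"

text \<open>The face \<open>\<gamma>\<close> may be empty, so a full simplex is \<open>0\<close>-collapsible.\<close>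

definition elementary_collapse :: "nat \<Rightarrow> 'a set set \<Rightarrow> 'a set set \<Rightarrow> bool" where
  "elementary_collapse d X Y \<longleftrightarrow>
     (\<exists>\<gamma>\<in>X. \<exists>\<sigma>\<in>X. card \<gamma> \<le> d \<and> {\<tau>. maximal_simplex X \<tau> \<and> \<gamma> \<subseteq> \<tau>} = {\<sigma>} \<and>
        Y = X - {\<tau>. \<gamma> \<subseteq> \<tau> \<and> \<tau> \<subseteq> \<sigma>})"

definition collapsible :: "nat \<Rightarrow> 'a set set \<Rightarrow> bool" where
  "collapsible d X \<longleftrightarrow> (elementary_collapse d)\<^sup>*\<^sup>* X {}"

text \<open>Removing maximal simplices one at a time (with \<open>\<gamma> = \<sigma>\<close>) shows that a complex is
  \<open>d\<close>-collapsible as soon as \<open>d\<close> bounds the size of its simplices, so the minimum exists.\<close>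

definition collapsibility_number :: "'a set set \<Rightarrow> nat" where
  "collapsibility_number X = (LEAST d. collapsible d X)"

definition lk :: "'a set \<Rightarrow> 'a set set \<Rightarrow> 'a set set" where
  "lk \<sigma> X = {\<tau>\<in>X. \<sigma> \<inter> \<tau> = {} \<and> \<sigma> \<union> \<tau> \<in> X}"

definition del :: "'a set \<Rightarrow> 'a set set \<Rightarrow> 'a set set" where
  "del \<sigma> X = {\<tau>\<in>X. \<not> \<sigma> \<subseteq> \<tau>}"

definition induced :: "'a set set \<Rightarrow> 'a set \<Rightarrow> 'a set set" where
  "induced X A = {\<sigma>\<in>X. \<sigma> \<subseteq> A}"

definition faces_dim :: "nat \<Rightarrow> 'a set set \<Rightarrow> 'a set set" where
  "faces_dim k X = {\<sigma>\<in>X. card \<sigma> = k + 1}"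

definition faces_o :: "nat \<Rightarrow> 'a set set \<Rightarrow> 'a set set" where
  "faces_o k X = {\<sigma> \<in> faces_dim k X. lk \<sigma> X \<noteq> induced X (vertices X - \<sigma>)}"

definition vertices_o :: "'a set set \<Rightarrow> 'a set" where
  "vertices_o X = {v \<in> vertices X. lk {v} X \<noteq> del {v} X}"

lemma card_lk_less: "finite X \<Longrightarrow> \<sigma> \<in> X \<Longrightarrow> \<sigma> \<noteq> {} \<Longrightarrow> card (lk \<sigma> X) < card X"
  by (rule psubset_card_mono) (auto simp: lk_def)

lemma card_del_less: "finite X \<Longrightarrow> \<sigma> \<in> X \<Longrightarrow> card (del \<sigma> X) < card X"
  by (rule psubset_card_mono) (auto simp: del_def)

text \<open>The recursions below are meant for simplicial complexes; the tests \<open>finite X\<close> only make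
  them terminate on arbitrary families of sets, and always hold for a complex.\<close>

context
  notes image_cong [fundef_cong]
begin

function \<M> :: "'a set set \<Rightarrow> nat" where
  "\<M> X = (if infinite X \<or> vertices_o X = {} then 0
     else Min ((\<lambda>v. max (\<M> (lk {v} X) + 1) (\<M> (del {v} X))) ` vertices_o X))"
  by pat_completeness auto
termination
  by (relation "measure card")
    (auto simp: vertices_o_def vertices_def intro: card_lk_less card_del_less)

text \<open>\<open>\<M>' k\<close> and \<open>\<M>_k k\<close> stand for $\mathcal{M}'_k$ and $\mathcal{M}_k$.\<close>

function \<M>' :: "nat \<Rightarrow> 'a set set \<Rightarrow> nat" and \<M>_k :: "nat \<Rightarrow> 'a set set \<Rightarrow> nat" where
  "\<M>' 0 X = \<M> X"
| "\<M>' (Suc k) X = (if infinite X \<or> faces_o (Suc k) X = {} then \<M>_k k X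
     else Min ((\<lambda>\<sigma>. max (\<M>' (Suc k) (del \<sigma> X)) (\<M>' (Suc k) (lk \<sigma> X) + Suc k + 1))
            ` faces_o (Suc k) X))"
| "\<M>_k 0 X = \<M> X"
| "\<M>_k (Suc k) X = min (\<M>' (Suc k) X) (\<M>_k k X)"
  by pat_completeness auto
termination
  by (relation "measures [case_sum fst fst, case_sum (\<lambda>p. card (snd p)) (\<lambda>p. card (snd p)),
        case_sum (\<lambda>_. 0) (\<lambda>_. 1)]")
    (auto simp: faces_o_def faces_dim_def intro!: card_lk_less card_del_less)

end

declare \<M>.simps [simp del]
declare \<M>'.simps(2) [simp del]

end

(* An elementary collapse of lk(s, X) along g lifts to an elementary collapse of X along the union
   of s and g that leaves del(s, X) untouched. Hence an e-collapse of lk(s, X) to the void complex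
   lifts to an (e + |s|)-collapse of X to del(s, X), which gives
   C(X) <= max {C(del(s, X)), C(lk(s, X)) + |s|}. Every recursion step follows from this bound;
   at the bottom, a complex with no vertex v satisfying lk(v, X) ~= del(v, X) is void or a full
   simplex. *)

theory Submission
  imports Defs
begin

section \<open>Links, deletions and collapses as complexes\<close>

lemma simplicial_complexD:
  assumes "simplicial_complex X"
  shows "finite X" "\<sigma> \<in> X \<Longrightarrow> finite \<sigma>" "\<sigma> \<in> X \<Longrightarrow> \<tau> \<subseteq> \<sigma> \<Longrightarrow> \<tau> \<in> X"
  using assms by (auto simp: simplicial_complex_def)

lemma simplicial_complex_subset:
  assumes "simplicial_complex X" "Y \<subseteq> X" "\<And>\<sigma> \<tau>. \<sigma> \<in> Y \<Longrightarrow> \<tau> \<subseteq> \<sigma> \<Longrightarrow> \<tau> \<in> Y"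
  shows "simplicial_complex Y"
  unfolding simplicial_complex_def
proof (intro conjI ballI allI impI)
  show "finite Y"
    using assms(1,2) simplicial_complexD(1) finite_subset by blast
  show "finite \<sigma>" if "\<sigma> \<in> Y" for \<sigma>
    using assms(1,2) simplicial_complexD(2) that by blast
qed (use assms(3) in blast)

lemma simplicial_complex_lk:
  assumes "simplicial_complex X"
  shows "simplicial_complex (lk \<sigma> X)"
proof -
  have "\<tau>' \<in> lk \<sigma> X" if "\<tau> \<in> lk \<sigma> X" "\<tau>' \<subseteq> \<tau>" for \<tau> \<tau>'
  proof -
    have "\<tau> \<in> X" "\<sigma> \<inter> \<tau> = {}" "\<sigma> \<union> \<tau> \<in> X"
      using that by (auto simp: lk_def)
    moreover have "\<sigma> \<union> \<tau>' \<subseteq> \<sigma> \<union> \<tau>"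
      using that by auto
    ultimately show ?thesis
      using that simplicial_complexD(3)[OF assms] unfolding lk_def by blast
  qed
  moreover have "lk \<sigma> X \<subseteq> X"
    by (auto simp: lk_def)
  ultimately show ?thesis
    using simplicial_complex_subset[OF assms] by blast
qed

lemma simplicial_complex_del:
  assumes "simplicial_complex X"
  shows "simplicial_complex (del \<sigma> X)"
proof (rule simplicial_complex_subset[OF assms])
  show "del \<sigma> X \<subseteq> X"
    by (auto simp: del_def)
  show "\<tau>' \<in> del \<sigma> X" if "\<tau> \<in> del \<sigma> X" "\<tau>' \<subseteq> \<tau>" for \<tau> \<tau>'
    using that simplicial_complexD(3)[OF assms] unfolding del_def by blast
qed

lemma elementary_collapseE:
  assumes "elementary_collapse d X Y"
  obtains \<gamma> \<sigma> where "\<gamma> \<in> X" "\<sigma> \<in> X" "card \<gamma> \<le> d"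
    "{\<tau>. maximal_simplex X \<tau> \<and> \<gamma> \<subseteq> \<tau>} = {\<sigma>}" "Y = X - {\<tau>. \<gamma> \<subseteq> \<tau> \<and> \<tau> \<subseteq> \<sigma>}"
  using assms unfolding elementary_collapse_def by (elim bexE conjE) (rule that; assumption)

text \<open>The removed interval consists of all faces containing \<open>\<gamma>\<close>, so no
  face that stays has a removed subset.\<close>

lemma simplicial_complex_collapse:
  assumes X: "simplicial_complex X" and XY: "elementary_collapse d X Y"
  shows "simplicial_complex Y"
proof -
  obtain \<gamma> \<sigma> where max: "{\<tau>. maximal_simplex X \<tau> \<and> \<gamma> \<subseteq> \<tau>} = {\<sigma>}"
    and Y: "Y = X - {\<tau>. \<gamma> \<subseteq> \<tau> \<and> \<tau> \<subseteq> \<sigma>}"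
    using XY by (elim elementary_collapseE) (rule that; assumption)
  \<comment> \<open>By finiteness \<open>\<tau>\<close> lies in a maximal face; that face contains
    \<open>\<gamma>\<close> too, so it is \<open>\<sigma>\<close> by uniqueness.\<close>
  have le: "\<tau> \<subseteq> \<sigma>" if \<tau>: "\<tau> \<in> X" "\<gamma> \<subseteq> \<tau>" for \<tau>
  proof -
    obtain \<rho> where "\<rho> \<in> X" "\<tau> \<subseteq> \<rho>" "\<forall>\<rho>'\<in>X. \<rho> \<subseteq> \<rho>' \<longrightarrow> \<rho> = \<rho>'"
      using finite_has_maximal2[OF simplicial_complexD(1)[OF X] \<tau>(1)] by blast
    then have "\<rho> \<in> {\<tau>. maximal_simplex X \<tau> \<and> \<gamma> \<subseteq> \<tau>}"
      using \<tau>(2) unfolding maximal_simplex_def by blast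
    then show ?thesis
      using max \<open>\<tau> \<subseteq> \<rho>\<close> by auto
  qed
  have "\<tau>' \<in> Y" if "\<tau> \<in> Y" "\<tau>' \<subseteq> \<tau>" for \<tau> \<tau>'
    using that le simplicial_complexD(3)[OF X] unfolding Y by blast
  moreover have "Y \<subseteq> X"
    by (auto simp: Y)
  ultimately show ?thesis
    using simplicial_complex_subset[OF X] by blast
qed

section \<open>Lifting collapses from a link\<close>

lemma maximal_simplex_lk_iff:
  assumes X: "simplicial_complex X" and "\<sigma> \<subseteq> \<tau>"
  shows "maximal_simplex (lk \<sigma> X) (\<tau> - \<sigma>) \<longleftrightarrow> maximal_simplex X \<tau>"
proof -
  \<comment> \<open>Subtracting \<open>\<sigma>\<close> is an inclusion-preserving bijection from
    the faces of \<open>X\<close> containing \<open>\<sigma>\<close> onto the link. Maximality of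
    \<open>\<tau>\<close> is tested only against faces above \<open>\<tau>\<close>, all of which
    contain \<open>\<sigma>\<close>, so it transfers both ways.\<close>
  have lk: "\<rho> - \<sigma> \<in> lk \<sigma> X \<longleftrightarrow> \<rho> \<in> X" if "\<sigma> \<subseteq> \<rho>" for \<rho>
  proof -
    have "\<sigma> \<union> (\<rho> - \<sigma>) = \<rho>" using that by auto
    then show ?thesis
      using simplicial_complexD(3)[OF X, of \<rho> "\<rho> - \<sigma>"] by (auto simp: lk_def)
  qed
  show ?thesis
  proof
    assume max: "maximal_simplex (lk \<sigma> X) (\<tau> - \<sigma>)"
    have "\<rho> = \<tau>" if "\<rho> \<in> X" "\<tau> \<subseteq> \<rho>" for \<rho>
    proof -
      have "\<rho> - \<sigma> \<in> lk \<sigma> X" "\<tau> - \<sigma> \<subseteq> \<rho> - \<sigma>"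
        using lk[of \<rho>] that assms(2) by auto
      then have "\<rho> - \<sigma> = \<tau> - \<sigma>"
        using max unfolding maximal_simplex_def by metis
      then show ?thesis
        using that assms(2) by blast
    qed
    then show "maximal_simplex X \<tau>"
      using max lk[of \<tau>] assms(2) unfolding maximal_simplex_def by metis
  next
    assume max: "maximal_simplex X \<tau>"
    have "\<rho> = \<tau> - \<sigma>" if "\<rho> \<in> lk \<sigma> X" "\<tau> - \<sigma> \<subseteq> \<rho>" for \<rho>
    proof -
      have "\<sigma> \<union> \<rho> \<in> X" "\<tau> \<subseteq> \<sigma> \<union> \<rho>"
        using that by (auto simp: lk_def)
      then have "\<sigma> \<union> \<rho> = \<tau>"
        using max unfolding maximal_simplex_def by metis
      then show ?thesis
        using that by (auto simp: lk_def)
    qed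
    then show "maximal_simplex (lk \<sigma> X) (\<tau> - \<sigma>)"
      using max lk[of \<tau>] assms(2) unfolding maximal_simplex_def by metis
  qed
qed

lemma elementary_collapse_lk_lift:
  assumes X: "simplicial_complex X"
    and coll: "elementary_collapse d (lk \<sigma> X) L"
  shows "\<exists>Y. elementary_collapse (d + card \<sigma>) X Y \<and> lk \<sigma> Y = L \<and> del \<sigma> Y = del \<sigma> X"
proof -
  obtain \<gamma> \<rho> where \<gamma>: "\<gamma> \<in> lk \<sigma> X" and \<rho>: "\<rho> \<in> lk \<sigma> X" and card: "card \<gamma> \<le> d"
    and max: "{\<tau>. maximal_simplex (lk \<sigma> X) \<tau> \<and> \<gamma> \<subseteq> \<tau>} = {\<rho>}"
    and L: "L = lk \<sigma> X - {\<tau>. \<gamma> \<subseteq> \<tau> \<and> \<tau> \<subseteq> \<rho>}"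
    using coll by (elim elementary_collapseE) (rule that; assumption)
  have disj: "\<sigma> \<inter> \<gamma> = {}" "\<sigma> \<inter> \<rho> = {}" and inX: "\<gamma> \<union> \<sigma> \<in> X" "\<rho> \<union> \<sigma> \<in> X"
    using \<gamma> \<rho> by (auto simp: lk_def Un_commute)
  define Y where "Y = X - {\<tau>. \<gamma> \<union> \<sigma> \<subseteq> \<tau> \<and> \<tau> \<subseteq> \<rho> \<union> \<sigma>}"
  \<comment> \<open>Under the correspondence with the link, maximal faces of \<open>X\<close> over
    \<open>\<gamma> \<union> \<sigma>\<close> become maximal faces of the link over
    \<open>\<gamma>\<close>, and there \<open>\<rho>\<close> is the only one.\<close>
  have "maximal_simplex X \<tau> \<and> \<gamma> \<union> \<sigma> \<subseteq> \<tau> \<longleftrightarrow> \<tau> = \<rho> \<union> \<sigma>" for \<tau>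
  proof
    assume \<tau>: "maximal_simplex X \<tau> \<and> \<gamma> \<union> \<sigma> \<subseteq> \<tau>"
    then have "maximal_simplex (lk \<sigma> X) (\<tau> - \<sigma>)" "\<gamma> \<subseteq> \<tau> - \<sigma>"
      using maximal_simplex_lk_iff[OF X, of \<sigma> \<tau>] disj by auto
    then have "\<tau> - \<sigma> = \<rho>"
      using eqset_imp_iff[OF max, of "\<tau> - \<sigma>"] by simp
    then show "\<tau> = \<rho> \<union> \<sigma>"
      using \<tau> by auto
  next
    assume \<tau>: "\<tau> = \<rho> \<union> \<sigma>"
    have "maximal_simplex (lk \<sigma> X) \<rho>" "\<gamma> \<subseteq> \<rho>"
      using eqset_imp_iff[OF max, of \<rho>] by simp_all
    moreover have "\<tau> - \<sigma> = \<rho>"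
      using \<tau> disj by auto
    ultimately show "maximal_simplex X \<tau> \<and> \<gamma> \<union> \<sigma> \<subseteq> \<tau>"
      using maximal_simplex_lk_iff[OF X, of \<sigma> \<tau>] \<tau> by auto
  qed
  then have "{\<tau>. maximal_simplex X \<tau> \<and> \<gamma> \<union> \<sigma> \<subseteq> \<tau>} = {\<rho> \<union> \<sigma>}"
    by auto
  moreover have "card (\<gamma> \<union> \<sigma>) \<le> d + card \<sigma>"
    using card card_Un_le[of \<gamma> \<sigma>] by simp
  ultimately have "elementary_collapse (d + card \<sigma>) X Y"
    using inX unfolding elementary_collapse_def Y_def by blast
  moreover have "lk \<sigma> Y = L"
  proof (rule set_eqI)
    fix \<tau>
    have "\<gamma> \<union> \<sigma> \<subseteq> \<sigma> \<union> \<tau> \<and> \<sigma> \<union> \<tau> \<subseteq> \<rho> \<union> \<sigma> \<longleftrightarrow> \<gamma> \<subseteq> \<tau> \<and> \<tau> \<subseteq> \<rho>" if "\<sigma> \<inter> \<tau> = {}"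
      using disj that by blast
    \<comment> \<open>A face of \<open>lk \<sigma> Y\<close> must itself survive in
      \<open>Y\<close>, not only its union with \<open>\<sigma>\<close>. A \<open>\<tau>\<close>
      disjoint from \<open>\<sigma>\<close> meets the removed interval only if
      \<open>\<sigma>\<close> is empty, and then it is absent from \<open>L\<close> as well.\<close>
    moreover have "\<gamma> \<subseteq> \<tau> \<and> \<tau> \<subseteq> \<rho>" if "\<gamma> \<union> \<sigma> \<subseteq> \<tau>" "\<tau> \<subseteq> \<rho> \<union> \<sigma>" "\<sigma> \<inter> \<tau> = {}"
      using that by blast
    ultimately show "\<tau> \<in> lk \<sigma> Y \<longleftrightarrow> \<tau> \<in> L"
      by (auto simp only: L Y_def lk_def mem_Collect_eq Diff_iff)
  qed
  moreover have "del \<sigma> Y = del \<sigma> X"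
    by (auto simp: Y_def del_def)
  ultimately show ?thesis by blast
qed

text \<open>Iterates the single lift. Keeping \<open>Y\<close> a complex whose link is the current
  \<open>L\<close> is what allows the next collapse of \<open>L\<close> to be lifted in
  turn.\<close>

lemma collapse_lk_lift:
  assumes "(elementary_collapse d)\<^sup>*\<^sup>* (lk \<sigma> X) L" "simplicial_complex X"
  shows "\<exists>Y. (elementary_collapse (d + card \<sigma>))\<^sup>*\<^sup>* X Y \<and> simplicial_complex Y \<and>
    lk \<sigma> Y = L \<and> del \<sigma> Y = del \<sigma> X"
  using assms(1)
proof (induction rule: rtranclp_induct)
  case base
  then show ?case using assms(2) by blast
next
  case (step L L')
  then obtain Y where Y: "(elementary_collapse (d + card \<sigma>))\<^sup>*\<^sup>* X Y" "simplicial_complex Y"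
    "lk \<sigma> Y = L" "del \<sigma> Y = del \<sigma> X"
    by blast
  moreover obtain Z where "elementary_collapse (d + card \<sigma>) Y Z" "lk \<sigma> Z = L'"
    "del \<sigma> Z = del \<sigma> Y"
    using elementary_collapse_lk_lift[OF Y(2)] step.hyps(2) Y(3) by metis
  ultimately show ?case
    using simplicial_complex_collapse by (metis rtranclp.rtrancl_into_rtrancl)
qed

lemma elementary_collapse_mono: "d \<le> e \<Longrightarrow> elementary_collapse d \<le> elementary_collapse e"
  unfolding elementary_collapse_def by (blast intro: le_trans)

lemma collapsible_mono:
  assumes "collapsible d X" "d \<le> e"
  shows "collapsible e X"
  using assms(1) rtranclp_mono[OF elementary_collapse_mono[OF assms(2)]]
  unfolding collapsible_def by blast

lemma collapsible_del_lk:
  assumes X: "simplicial_complex X"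
    and del: "collapsible d (del \<sigma> X)" and lk: "collapsible e (lk \<sigma> X)"
  shows "collapsible (max d (e + card \<sigma>)) X"
proof -
  obtain Y where Y: "(elementary_collapse (e + card \<sigma>))\<^sup>*\<^sup>* X Y" "simplicial_complex Y"
    "lk \<sigma> Y = {}" "del \<sigma> Y = del \<sigma> X"
    using collapse_lk_lift[OF _ X] lk unfolding collapsible_def by metis
  \<comment> \<open>Otherwise the empty face would belong to the link. Here it matters that the link
    has been collapsed to the void complex \<open>{}\<close> and not merely to
    \<open>{{}}\<close>.\<close>
  have "\<sigma> \<notin> Y"
    using Y(3) simplicial_complexD(3)[OF Y(2), of \<sigma> "{}"] by (auto simp: lk_def)
  then have "del \<sigma> Y = Y"
    using simplicial_complexD(3)[OF Y(2)] by (auto simp: del_def)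
  moreover have "(elementary_collapse (max d (e + card \<sigma>)))\<^sup>*\<^sup>* X Y"
    using Y(1) rtranclp_mono[OF elementary_collapse_mono[OF max.cobounded2]] by blast
  moreover have "collapsible (max d (e + card \<sigma>)) (del \<sigma> X)"
    using del by (rule collapsible_mono) simp
  ultimately show ?thesis
    using Y(4) unfolding collapsible_def by auto
qed

text \<open>Every vertex is a cone point, so a nonvoid \<open>X\<close> is the full simplex on its
  vertices. It vanishes in one collapse along the empty face, which has size 0.\<close>

lemma collapsible_0_if_vertices_o_empty:
  assumes X: "simplicial_complex X" and no: "vertices_o X = {}"
  shows "collapsible 0 X"
proof (cases "X = {}")
  case True
  then show ?thesis by (simp add: collapsible_def)
next
  case False
  let ?V = "vertices X"
  have "?V \<subseteq> \<Union>X"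
    by (auto simp: vertices_def)
  then have fin: "finite ?V"
    using simplicial_complexD(1,2)[OF X] by (blast intro: finite_subset)
  have "A \<in> X" if "finite A" "A \<subseteq> ?V" for A
    using that
  proof (induction A rule: finite_induct)
    case empty
    then show ?case using False simplicial_complexD(3)[OF X] by blast
  next
    case (insert v A)
    \<comment> \<open>Since \<open>v\<close> is not in \<open>A\<close>, the face \<open>A\<close>
      lies in the deletion of \<open>v\<close>, hence in its link, and this puts
      \<open>insert v A\<close> into \<open>X\<close>.\<close>
    then have "A \<in> del {v} X"
      by (auto simp: del_def)
    moreover have "lk {v} X = del {v} X"
      using no insert.prems by (auto simp: vertices_o_def)
    ultimately show ?case by (auto simp: lk_def)
  qed
  moreover have "\<tau> \<subseteq> ?V" if "\<tau> \<in> X" for \<tau>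
    using simplicial_complexD(3)[OF X that] by (auto simp: vertices_def)
  ultimately have "A \<in> X \<longleftrightarrow> A \<subseteq> ?V" for A
    using finite_subset[OF _ fin, of A] by metis
  then have eq: "X = Pow ?V"
    by (simp add: set_eq_iff)
  have "{\<tau>. maximal_simplex (Pow V) \<tau> \<and> {} \<subseteq> \<tau>} = {V}" for V :: "'a set"
    by (auto simp: maximal_simplex_def)
  then have "elementary_collapse 0 (Pow V) {}" for V :: "'a set"
    unfolding elementary_collapse_def by (intro bexI[of _ "{}"] bexI[of _ V]) auto
  then have "elementary_collapse 0 X {}"
    by (subst eq)
  then show ?thesis by (auto simp: collapsible_def)
qed

text \<open>Induction on the number of faces, which drops for both link and deletion. The increment
  1 in the recursion is the size of the face \<open>{v}\<close>.\<close>

lemma collapsible_\<M>: "simplicial_complex X \<Longrightarrow> collapsible (\<M> X) X"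
proof (induction "card X" arbitrary: X rule: less_induct)
  case less
  note fin = simplicial_complexD(1)[OF less.prems]
  show ?case
  proof (cases "vertices_o X = {}")
    case True
    then show ?thesis
      using collapsible_0_if_vertices_o_empty[OF less.prems] by (simp add: \<M>.simps[of X])
  next
    case False
    let ?f = "\<lambda>v. max (\<M> (lk {v} X) + 1) (\<M> (del {v} X))"
    have "vertices_o X \<subseteq> \<Union>X"
      by (auto simp: vertices_o_def vertices_def)
    then have "finite (vertices_o X)"
      using simplicial_complexD(1,2)[OF less.prems] by (blast intro: finite_subset)
    \<comment> \<open>The minimum is attained, so it suffices to collapse \<open>X\<close> through
      one minimizing vertex.\<close>
    then have "Min (?f ` vertices_o X) \<in> ?f ` vertices_o X"
      using False by (intro Min_in) auto
    then obtain v where v: "v \<in> vertices_o X" and eq: "\<M> X = ?f v"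
      using fin False by (auto simp: \<M>.simps[of X])
    have vX: "{v} \<in> X"
      using v by (auto simp: vertices_o_def vertices_def)
    have "collapsible (\<M> (del {v} X)) (del {v} X)" "collapsible (\<M> (lk {v} X)) (lk {v} X)"
      using vX by (auto intro!: less.hyps card_del_less card_lk_less fin
          simplicial_complex_del simplicial_complex_lk less.prems)
    then show ?thesis
      using collapsible_del_lk[OF less.prems] eq by (fastforce simp: max.commute)
  qed
qed

lemma collapsible_\<M>_k: "simplicial_complex X \<Longrightarrow> collapsible (\<M>_k k X) X"
proof (induction k arbitrary: X)
  case 0
  then show ?case by (simp add: collapsible_\<M>)
next
  case (Suc k)
  have "collapsible (\<M>' (Suc k) X) X"
    \<comment> \<open>Inside the induction on \<open>k\<close>, a second one on the number of faces
      follows the recursion of \<open>\<M>'\<close>. The outer hypothesis enters where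
      \<open>\<M>'\<close> falls back to \<open>\<M>_k k\<close>.\<close>
    using Suc.prems
  proof (induction "card X" arbitrary: X rule: less_induct)
    case less
    note fin = simplicial_complexD(1)[OF less.prems]
    show ?case
    proof (cases "faces_o (Suc k) X = {}")
      case True
      then show ?thesis
        using Suc.IH[OF less.prems] by (simp add: \<M>'.simps(2))
    next
      case False
      let ?f = "\<lambda>\<sigma>. max (\<M>' (Suc k) (del \<sigma> X)) (\<M>' (Suc k) (lk \<sigma> X) + Suc k + 1)"
      have "finite (faces_o (Suc k) X)"
        using fin by (auto simp: faces_o_def faces_dim_def)
      then have "Min (?f ` faces_o (Suc k) X) \<in> ?f ` faces_o (Suc k) X"
        using False by (intro Min_in) auto
      then obtain \<sigma> where \<sigma>: "\<sigma> \<in> faces_o (Suc k) X" and eq: "\<M>' (Suc k) X = ?f \<sigma>"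
        using fin False by (auto simp: \<M>'.simps(2)[of k X])
      \<comment> \<open>A face of dimension \<open>Suc k\<close> has \<open>Suc k + 1\<close>
        vertices, exactly the increment on the link side of the recursion.\<close>
      have \<sigma>X: "\<sigma> \<in> X" "card \<sigma> = Suc k + 1" "\<sigma> \<noteq> {}"
        using \<sigma> by (auto simp: faces_o_def faces_dim_def)
      have "collapsible (\<M>' (Suc k) (del \<sigma> X)) (del \<sigma> X)"
        "collapsible (\<M>' (Suc k) (lk \<sigma> X)) (lk \<sigma> X)"
        using \<sigma>X by (auto intro!: less.hyps card_del_less card_lk_less fin
            simplicial_complex_del simplicial_complex_lk less.prems)
      from collapsible_del_lk[OF less.prems this] show ?thesis
        unfolding eq \<sigma>X(2) by (simp add: add.assoc)
    qed
  qed
  \<comment> \<open>The minimum equals one of its two arguments, and \<open>X\<close> is collapsible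
    for either value.\<close>
  then show ?case
    using Suc by (simp add: min_def)
qed

theorem theorem3p7:
  fixes X :: "'a set set" and k :: nat
  assumes "simplicial_complex X"
  shows "collapsibility_number X \<le> \<M>_k k X"
  unfolding collapsibility_number_def using collapsible_\<M>_k[OF assms] by (rule Least_le)

end
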